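(* Let $P$ be a poset and let $\to$ be a total binary operation on $P$. Then $\to$ is an extended sectional pseudocomplementation on $P$ if and only if the following three conditions hold for all $x,y,z\in P$: (1) if $z\le x\le y$, then $y\to z\le x\to z$; (2) if $y\le x\le x\to y$, then $x\le y$; (3) if $z$ is a maximal lower bound of $x$ and $y$, then $x\le y\to z$.
   Context: For a poset $P$ and $y\in P$ put $[y)=\{u\in P: y\le u\}$. For $x,y,p \in P$, $x\wedge_p y=z$ means that $p\le x,y$ and $z$ is the greatest element of the set of common lower bounds of $x$ and $y$ lying in $[p)$. For $y\le x$, a pseudocomplement of $x$ in $[y)$ is the greatest element of $\{u\in P: u\wedge_y x=y\}$, i.e. the greatest $u\ge y$ such that $y$ is the only common lower bound of $u$ and $x$ in $[y)$. A total binary operation $\to$ on $P$ is an extended sectional pseudocomplementation if, for all $x,y$ with $y\le x$, $x\to y$ is the pseudocomplement of $x$ in $[y)$ (in particular this pseudocomplement exists); no condition is imposed on $x\to y$ when $y\not\le x$. A maximal lower bound of $x$ and $y$ is a maximal element of the set of common lower bounds of $x$ and $y$ in $P$. *)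

theory Defs
  imports "HOL-Library.Lub_Glb"
begin

text \<open>
  \<open>x \<and>\<^sub>p y = z\<close> is a partial operation, hence rendered as a relation; \<open>{p..}\<close> is \<open>[p)\<close> and
  \<open>isGlb {p..} {x, y} z\<close> says that \<open>z\<close> is the greatest of the common lower bounds of \<open>x\<close>
  and \<open>y\<close> lying in \<open>{p..}\<close>.
\<close>

definition sect_meet :: "'a::order \<Rightarrow> 'a \<Rightarrow> 'a \<Rightarrow> 'a \<Rightarrow> bool" where
  "sect_meet p x y z \<longleftrightarrow> p \<le> x \<and> p \<le> y \<and> isGlb {p..} {x, y} z"

text \<open>
  \<open>sect_pseudocomplement y x c\<close>: \<open>c\<close> is the pseudocomplement of \<open>x\<close> in \<open>[y)\<close>; intended
  for \<open>y \<le> x\<close> only, and false otherwise.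
\<close>

definition sect_pseudocomplement :: "'a::order \<Rightarrow> 'a \<Rightarrow> 'a \<Rightarrow> bool" where
  "sect_pseudocomplement y x c \<longleftrightarrow> greatestP (\<lambda>u. sect_meet y u x y) c"

definition ext_sect_pseudocomplementation :: "('a::order \<Rightarrow> 'a \<Rightarrow> 'a) \<Rightarrow> bool" where
  "ext_sect_pseudocomplementation imp \<longleftrightarrow>
     (\<forall>x y. y \<le> x \<longrightarrow> sect_pseudocomplement y x (imp x y))"

definition maximal_lower_bound :: "'a::order \<Rightarrow> 'a \<Rightarrow> 'a \<Rightarrow> bool" where
  "maximal_lower_bound x y z \<longleftrightarrow>
     z \<in> lbs UNIV {x, y} \<and> (\<forall>w \<in> lbs UNIV {x, y}. z \<le> w \<longrightarrow> w = z)"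

end

theory Submission
  imports Defs
begin

text \<open>
  The relation \<open>u \<and>\<^sub>y x = y\<close> says exactly that \<open>y\<close> is a maximal lower bound of \<open>u\<close> and \<open>x\<close>.
  Hence (3) amounts to every \<open>u\<close> with \<open>u \<and>\<^sub>y x = y\<close> lying below \<open>x \<rightarrow> y\<close>, while (1) and (2) force
  a common lower bound \<open>w \<ge> y\<close> of \<open>x\<close> and \<open>x \<rightarrow> y\<close> to satisfy \<open>w \<le> x \<rightarrow> y \<le> w \<rightarrow> y\<close>, so \<open>w = y\<close>.
\<close>

lemma maximal_lower_bound_iff:
  "maximal_lower_bound x y z \<longleftrightarrow>
     z \<le> x \<and> z \<le> y \<and> (\<forall>w. z \<le> w \<and> w \<le> x \<and> w \<le> y \<longrightarrow> w = z)"
  by (auto simp: maximal_lower_bound_def lbs_def isLb_def setge_def)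

text \<open>Every element of \<open>{y..}\<close> is at least \<open>y\<close>, so \<open>y\<close>
  is greatest among the common lower bounds there only if it is the sole one.\<close>

lemma sect_meet_base_iff: "sect_meet y u x y \<longleftrightarrow> maximal_lower_bound u x y"
  unfolding sect_meet_def maximal_lower_bound_iff
  by (auto simp: isGlb_def greatestP_def lbs_def isLb_def setge_def setle_def intro: order.antisym)

lemma sect_pseudocomplement_iff:
  "sect_pseudocomplement y x c \<longleftrightarrow>
     maximal_lower_bound c x y \<and> (\<forall>u. maximal_lower_bound u x y \<longrightarrow> u \<le> c)"
  by (auto simp: sect_pseudocomplement_def sect_meet_base_iff greatestP_def setle_def)

theorem proposition3p2:
  fixes imp :: "'a::order \<Rightarrow> 'a \<Rightarrow> 'a"
  shows "ext_sect_pseudocomplementation imp \<longleftrightarrow>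
    (\<forall>x y z. z \<le> x \<and> x \<le> y \<longrightarrow> imp y z \<le> imp x z) \<and>
    (\<forall>x y. y \<le> x \<and> x \<le> imp x y \<longrightarrow> x \<le> y) \<and>
    (\<forall>x y z. maximal_lower_bound x y z \<longrightarrow> x \<le> imp y z)"
  (is "_ \<longleftrightarrow> ?antitone \<and> ?cancel \<and> ?bound")
proof
  assume "ext_sect_pseudocomplementation imp"
  then have mlb: "maximal_lower_bound (imp x y) x y"
    and greatest: "maximal_lower_bound u x y \<Longrightarrow> u \<le> imp x y" if "y \<le> x" for u x y :: 'a
    using that by (auto simp: ext_sect_pseudocomplementation_def sect_pseudocomplement_iff)
  have ?antitone
  proof (intro allI impI, elim conjE)
    fix x y z :: 'a assume "z \<le> x" "x \<le> y"
    \<comment> \<open>Since \<open>x \<le> y\<close>, common lower bounds of \<open>imp y z\<close>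
      and \<open>x\<close> also lie below \<open>y\<close>, so maximality of \<open>z\<close>
      carries over.\<close>
    then have "maximal_lower_bound (imp y z) x z"
      using mlb[of z y] by (auto simp: maximal_lower_bound_iff)
    then show "imp y z \<le> imp x z"
      using greatest \<open>z \<le> x\<close> by blast
  qed
  \<comment> \<open>Take \<open>w = x\<close> in the maximality of \<open>y\<close>.\<close>
  moreover have ?cancel
    using mlb unfolding maximal_lower_bound_iff by blast
  moreover have ?bound
    using greatest by (simp add: maximal_lower_bound_iff)
  ultimately show "?antitone \<and> ?cancel \<and> ?bound"
    by blast
next
  assume "?antitone \<and> ?cancel \<and> ?bound"
  then have antitone: ?antitone and cancel: ?cancel and bound: ?bound
    by blast+
  have "maximal_lower_bound (imp x y) x y" if "y \<le> x" for x y :: 'a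
    unfolding maximal_lower_bound_iff
  proof (intro conjI allI impI; (elim conjE)?)
    \<comment> \<open>As \<open>y \<le> x\<close>, \<open>y\<close> is a maximal lower bound of
      \<open>y\<close> and \<open>x\<close>; (3) applies with \<open>y\<close> in its first
      place.\<close>
    have "maximal_lower_bound y x y"
      using that by (auto simp: maximal_lower_bound_iff)
    then show "y \<le> imp x y"
      using bound by blast
    fix w assume w: "y \<le> w" "w \<le> imp x y" "w \<le> x"
    have "w \<le> imp w y"
      using antitone w order.trans by blast
    then show "w = y"
      using cancel w(1) order.antisym by blast
  qed (fact that)
  then show "ext_sect_pseudocomplementation imp"
    using bound by (simp add: ext_sect_pseudocomplementation_def sect_pseudocomplement_iff)
qed

end
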